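(* $\displaystyle\lim_{n\to\infty}\left(h_1(\Delta^{[n]})-\frac{n}{3}\right)=0$, where $n$ runs over all integers $n\geq 3$.
   Context: $[n]=\{1,\dots,n\}$ and $\Delta^{[n]}$ denotes the full simplex on the vertex set $[n]$ (all subsets of $[n]$ are simplices). For a finite simplicial complex $X$, let $C^k(X)$ be the $k$-cochains with $\mathbb{Z}_2$-coefficients, and let $\partial^*$ be the coboundary operator. For a cochain $c$, the norm $\|c\|$ is the number of $k$-simplices on which $c$ takes the value $1$. The cosystolic norm of a $k$-cochain $c$ is $\|c\|_{\mathrm{csy}}:=\min_{d\in C^{k-1}(X)}\|c+\partial^* d\|$. The $k$-th Cheeger constant of $X$ is $h_k(X):=\min_c \|\partial^* c\|/\|c\|_{\mathrm{csy}}$, where the minimum is taken over all $c\in C^k(X)$ which are not coboundaries. *)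

theory Defs
  imports Complex_Main "HOL-Library.Z2"
begin

text \<open>
  A finite simplicial complex is a finite family of finite sets closed under taking subsets.
  Dimensions are integers, so that the empty simplex has dimension -1 and the \<open>(k - 1)\<close>-cochains
  make sense for \<open>k = 0\<close> as well.
\<close>

definition simplices :: "'a set set \<Rightarrow> int \<Rightarrow> 'a set set" where
  "simplices X k = {\<sigma> \<in> X. finite \<sigma> \<and> int (card \<sigma>) = k + 1}"

definition full_simplex :: "'a set \<Rightarrow> 'a set set" where
  "full_simplex V = Pow V"

text \<open>
  Cochains are total functions into the two-element field, extended by zero outside
  the \<open>k\<close>-simplices; equality of cochains is therefore equality of functions.
\<close>

definition cochains :: "'a set set \<Rightarrow> int \<Rightarrow> ('a set \<Rightarrow> bit) set" where
  "cochains X k = {c. \<forall>\<sigma>. \<sigma> \<notin> simplices X k \<longrightarrow> c \<sigma> = 0}"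

definition coboundary :: "'a set set \<Rightarrow> int \<Rightarrow> ('a set \<Rightarrow> bit) \<Rightarrow> 'a set \<Rightarrow> bit" where
  "coboundary X k c =
    (\<lambda>\<tau>. if \<tau> \<in> simplices X (k + 1) then \<Sum>\<sigma> | \<sigma> \<in> simplices X k \<and> \<sigma> \<subseteq> \<tau>. c \<sigma> else 0)"

definition cochain_norm :: "'a set set \<Rightarrow> int \<Rightarrow> ('a set \<Rightarrow> bit) \<Rightarrow> nat" where
  "cochain_norm X k c = card {\<sigma> \<in> simplices X k. c \<sigma> = 1}"

definition cosystolic_norm :: "'a set set \<Rightarrow> int \<Rightarrow> ('a set \<Rightarrow> bit) \<Rightarrow> nat" where
  "cosystolic_norm X k c =
    Min ((\<lambda>d. cochain_norm X k (\<lambda>\<sigma>. c \<sigma> + coboundary X (k - 1) d \<sigma>)) ` cochains X (k - 1))"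

text \<open>
  Both minima range over finite sets when \<open>X\<close> is finite. The value of the Cheeger constant is
  meaningful only if some \<open>k\<close>-cochain is not a coboundary, since \<^term>\<open>Min {}\<close> is unspecified;
  for \<open>k = 1\<close> and the full simplex on \<open>n\<close> vertices this means \<open>n \<ge> 3\<close>.
\<close>

definition cheeger_constant :: "int \<Rightarrow> 'a set set \<Rightarrow> real" where
  "cheeger_constant k X =
    Min ((\<lambda>c. real (cochain_norm X (k + 1) (coboundary X k c)) / real (cosystolic_norm X k c)) `
      (cochains X k - coboundary X (k - 1) ` cochains X (k - 1)))"

end

theory Submission
  imports Defs
begin

text \<open>
  Read a 1-cochain \<open>c\<close> of the simplex as a graph on \<open>{1..n}\<close>. Adding a coboundary switches the graph
  along a cut, and the coboundary of \<open>c\<close> marks the \<^emph>\<open>odd\<close> triples, those spanning an odd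
  number of edges; switching does not change which triples are odd.

  Lower bound: switching along the neighbourhood of a vertex \<open>v\<close> isolates \<open>v\<close>, and the edges that
  remain are exactly the pairs forming an odd triple with \<open>v\<close>. So the cosystolic norm is at most
  the number of odd triples through \<open>v\<close>. Summing over \<open>v\<close> counts every odd triple three times,
  which gives \<open>n / 3\<close> for all \<open>n\<close> (\<open>coboundary_expansion\<close>).

  Upper bound: a graph is needed for which all these vertex switchings are nearly minimal. Take a
  0-1 word \<open>w\<close> of length \<open>n\<close> and join \<open>u < v\<close> if \<open>w\<close> is 1 at \<open>u\<close> and 0 at \<open>v\<close>. A triple is odd iff
  its three letters alternate (\<open>cochain_norm_coboundary_word\<close>), so odd triples are easily counted
  when letters are appended. The edges that survive in every switching are counted in the same way:
  if letters 1 and 0 are appended at \<open>p\<close> and \<open>q\<close>, then an earlier letter 1 meets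
  exactly one edge to \<open>{p, q}\<close> when \<open>p\<close> and \<open>q\<close> lie on the same side of the cut, and an earlier letter
  0 does so when they lie on different sides (\<open>switched_pair_bound\<close>). Hence nearly balanced words
  keep many edges however the cut is chosen.

  For odd \<open>n\<close> the word \<open>0(10)\<dots>(10)\<close> attains \<open>n / 3\<close>. Doubling each letter gives
  \<open>00(1100)\<dots>(1100)\<close>, which attains \<open>n / 3\<close> for \<open>n \<equiv> 2 (mod 4)\<close>. For \<open>n \<equiv> 0 (mod 4)\<close> the word
  \<open>0100(1100)\<dots>(1100)\<close> gives a ratio above \<open>n / 3\<close> by a term of order \<open>1 / n\<close> only. Together this yields
  \<open>cheeger_constant_bounds\<close>, and the limit follows.
\<close>

section \<open>Switchings and odd triples of word graphs\<close>

definition ones :: "(nat \<Rightarrow> bool) \<Rightarrow> nat \<Rightarrow> nat" where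
  "ones w n = (\<Sum>u\<in>{1..n}. of_bool (w u))"

definition zeros :: "(nat \<Rightarrow> bool) \<Rightarrow> nat \<Rightarrow> nat" where
  "zeros w n = (\<Sum>u\<in>{1..n}. of_bool (\<not> w u))"

text \<open>
  For \<open>u < v\<close>, adjacency in the graph of \<open>w\<close> after switching along the cut given by \<open>x\<close>.
\<close>

definition switched_edge :: "(nat \<Rightarrow> bool) \<Rightarrow> (nat \<Rightarrow> bool) \<Rightarrow> nat \<Rightarrow> nat \<Rightarrow> bool" where
  "switched_edge w x u v \<longleftrightarrow> (w u \<and> \<not> w v) \<noteq> (x u \<noteq> x v)"

definition switched_edges :: "(nat \<Rightarrow> bool) \<Rightarrow> (nat \<Rightarrow> bool) \<Rightarrow> nat \<Rightarrow> nat" where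
  "switched_edges w x n = (\<Sum>v\<in>{1..n}. \<Sum>u\<in>{1..<v}. of_bool (switched_edge w x u v))"

text \<open>
  Subwords \<open>01\<close> (for \<open>b = True\<close>) or \<open>10\<close> (for \<open>b = False\<close>) of length two: the pairs that become
  alternating triples when the letter \<open>\<not> b\<close> is appended.
\<close>

definition jumps_to :: "bool \<Rightarrow> (nat \<Rightarrow> bool) \<Rightarrow> nat \<Rightarrow> nat" where
  "jumps_to b w n = (\<Sum>v\<in>{1..n}. \<Sum>u\<in>{1..<v}. of_bool (w u \<noteq> w v \<and> w v = b))"

definition alternating_triples :: "(nat \<Rightarrow> bool) \<Rightarrow> nat \<Rightarrow> nat" where
  "alternating_triples w n =
    (\<Sum>t\<in>{1..n}. \<Sum>v\<in>{1..<t}. \<Sum>u\<in>{1..<v}. of_bool (w u \<noteq> w v \<and> w v \<noteq> w t))"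

lemma ones_Suc: "ones w (Suc n) = ones w n + of_bool (w (Suc n))"
  and zeros_Suc: "zeros w (Suc n) = zeros w n + of_bool (\<not> w (Suc n))"
  by (simp_all add: ones_def zeros_def)

lemma switched_edges_Suc:
  "switched_edges w x (Suc n) =
    switched_edges w x n + (\<Sum>u\<in>{1..n}. of_bool (switched_edge w x u (Suc n)))"
  by (simp add: switched_edges_def atLeastLessThanSuc_atLeastAtMost)

lemma jumps_to_Suc:
  "jumps_to True w (Suc n) = jumps_to True w n + (if w (Suc n) then zeros w n else 0)"
  "jumps_to False w (Suc n) = jumps_to False w n + (if w (Suc n) then 0 else ones w n)"
  by (simp_all add: jumps_to_def ones_def zeros_def atLeastLessThanSuc_atLeastAtMost)

lemma alternating_triples_Suc:
  "alternating_triples w (Suc n) =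
    alternating_triples w n + jumps_to (\<not> w (Suc n)) w n"
  unfolding alternating_triples_def jumps_to_def
  by (simp add: atLeastLessThanSuc_atLeastAtMost; intro sum.cong refl; auto)

lemma jumps_total: "jumps_to True w n + jumps_to False w n = zeros w n * ones w n"
proof (induction n)
  case 0
  show ?case by (simp add: jumps_to_def zeros_def)
next
  case (Suc n)
  then show ?case
    by (simp add: jumps_to_Suc zeros_Suc ones_Suc algebra_simps)
qed

text \<open>
  Before switching, \<open>p\<close> has no edge to an earlier vertex, and \<open>q\<close> is joined precisely to the earlier
  letters 1. So if \<open>p\<close> and \<open>q\<close> are switched alike, each earlier 1 still distinguishes them and
  is joined to exactly one of them; if they are switched differently, this holds for each earlier 0.
\<close>

lemma switched_pair_bound:
  assumes "w p" "\<not> w q"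
  shows "(if x p = x q then ones w n else zeros w n) \<le>
    (\<Sum>u\<in>{1..n}. of_bool (switched_edge w x u p)) + (\<Sum>u\<in>{1..n}. of_bool (switched_edge w x u q))"
  using assms unfolding sum.distrib[symmetric] ones_def zeros_def
  by (auto intro!: sum_mono simp: switched_edge_def of_bool_def simp del: sum_of_bool_eq split: if_splits)

text \<open>
  With one more 0 than 1, both cases of the pair bound give the same amount: if the new vertices are
  switched alike, the edge between them survives and makes up for the missing vertex.
\<close>

lemma switched_edges_append_10:
  assumes "w (Suc n)" "\<not> w (Suc (Suc n))" and "zeros w n = Suc (ones w n)"
  shows "switched_edges w x n + Suc (ones w n) \<le> switched_edges w x (Suc (Suc n))"
  using switched_pair_bound[of w "Suc n" "Suc (Suc n)" x n] assms
  by (cases "x (Suc n) = x (Suc (Suc n))") (simp_all add: switched_edges_Suc switched_edge_def)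

text \<open>
  The four new vertices form two pairs to which the pair bound applies. The surplus of two zeros
  is chosen so that a cut separating the new ones from the new zeros, which destroys all edges
  among the four, leaves as many edges in total as a cut separating none of the four can leave.
\<close>

lemma switched_edges_append_1100:
  assumes "w (n + 1)" "w (n + 2)" "\<not> w (n + 3)" "\<not> w (n + 4)"
    and "zeros w n = ones w n + 2"
  shows "switched_edges w x n + (2 * ones w n + 4) \<le> switched_edges w x (n + 4)"
proof -
  define S where "S p = (\<Sum>u\<in>{1..n}. of_bool (switched_edge w x u p) :: nat)" for p
  have pair: "(if x p = x q then ones w n else ones w n + 2) \<le> S p + S q" if "w p" "\<not> w q" for p q
    using switched_pair_bound[OF that, of x n] assms(5)
    by (simp add: S_def del: sum_of_bool_eq split: if_splits)
  have n4: "n + 4 = Suc (Suc (Suc (Suc n)))" "n + 1 = Suc n" "n + 2 = Suc (Suc n)"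
    "n + 3 = Suc (Suc (Suc n))"
    by simp_all
  have split: "switched_edges w x (n + 4) = switched_edges w x n
      + (S (n + 1) + S (n + 3)) + (S (n + 2) + S (n + 4))
      + of_bool (x (n + 1) \<noteq> x (n + 2)) + of_bool (x (n + 3) \<noteq> x (n + 4))
      + of_bool (x (n + 1) = x (n + 3)) + of_bool (x (n + 1) = x (n + 4))
      + of_bool (x (n + 2) = x (n + 3)) + of_bool (x (n + 2) = x (n + 4))"
    using assms(1-4) unfolding n4 S_def
    by (simp add: switched_edges_Suc switched_edge_def)
  show ?thesis
    using pair[of "n + 1" "n + 3"] pair[of "n + 2" "n + 4"] assms(1-4) unfolding split
    by (cases "x (n + 1)"; cases "x (n + 2)"; cases "x (n + 3)"; cases "x (n + 4)") simp_all
qed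

text \<open>
  The new triples extend a subword \<open>10\<close> by the new 1, or a subword \<open>01\<close> by the new 0, where the
  latter may contain the new 1. Subwords \<open>10\<close> and \<open>01\<close> together make up all pairs of unequal
  letters, so the increment depends only on how many letters of each kind there are.
\<close>

lemma alternating_triples_append_10:
  assumes "w (Suc n)" "\<not> w (Suc (Suc n))"
  shows "alternating_triples w (Suc (Suc n)) =
    alternating_triples w n + zeros w n * Suc (ones w n)"
  using assms jumps_total[of w n] by (simp add: alternating_triples_Suc jumps_to_Suc)

lemma alternating_triples_append_1100:
  assumes "w (n + 1)" "w (n + 2)" "\<not> w (n + 3)" "\<not> w (n + 4)"
  shows "alternating_triples w (n + 4) =
    alternating_triples w n + 2 * zeros w n * (ones w n + 2)"
proof -
  have n4: "n + 4 = Suc (Suc (Suc (Suc n)))" "n + 1 = Suc n" "n + 2 = Suc (Suc n)"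
    "n + 3 = Suc (Suc (Suc n))"
    by simp_all
  show ?thesis
    using assms jumps_total[of w n] unfolding n4
    by (simp add: alternating_triples_Suc jumps_to_Suc zeros_Suc algebra_simps)
qed

text \<open>
  Letter \<open>i\<close> is 1 iff \<open>i\<close> is even, so this is the word \<open>0(10)\<dots>(10)\<close>. The bounds have ratio
  \<open>(2 s + 1) / 3\<close>, one third of the length.
\<close>

lemma alternating_word:
  fixes x :: "nat \<Rightarrow> bool"
  shows "s * (s + 1) \<le> 2 * switched_edges even x (2 * s + 1)"
    and "6 * alternating_triples even (2 * s + 1) = s * (s + 1) * (2 * s + 1)"
proof -
  have count: "ones even (2 * s + 1) = s \<and> zeros even (2 * s + 1) = Suc s" for s
    by (induction s) (simp_all add: ones_Suc zeros_Suc, simp_all add: ones_def zeros_def)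
  show "s * (s + 1) \<le> 2 * switched_edges even x (2 * s + 1)"
  proof (induction s)
    case (Suc s)
    then show ?case
      using switched_edges_append_10[of even "2 * s + 1" x] count[of s] by simp
  qed simp
  show "6 * alternating_triples even (2 * s + 1) = s * (s + 1) * (2 * s + 1)"
  proof (induction s)
    case 0
    show ?case by (simp add: alternating_triples_def)
  next
    case (Suc s)
    then show ?case
      using alternating_triples_append_10[of even "2 * s + 1"] count[of s]
      by (simp add: algebra_simps)
  qed
qed

text \<open>
  Appending \<open>1100\<close> preserves the surplus of two zeros, so the step can be iterated from any initial
  segment with that surplus; the two even word families differ only in this segment.
\<close>

lemma doubled_alternating_tail:
  assumes letters: "\<And>j. w (m + 4 * j + 1)" "\<And>j. w (m + 4 * j + 2)"
      "\<And>j. \<not> w (m + 4 * j + 3)" "\<And>j. \<not> w (m + 4 * j + 4)"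
    and balance: "zeros w m = ones w m + 2"
  shows "switched_edges w x m + 2 * s * (ones w m + s + 1) \<le> switched_edges w x (m + 4 * s)"
    and "alternating_triples w (m + 4 * s) =
      alternating_triples w m + (\<Sum>j<s. 2 * (ones w m + 2 * j + 2)\<^sup>2)"
proof -
  have step: "m + 4 * Suc s = m + 4 * s + 4" for s
    by simp
  have count: "ones w (m + 4 * s) = ones w m + 2 * s \<and> zeros w (m + 4 * s) = ones w m + 2 * s + 2" for s
  proof (induction s)
    case (Suc s)
    have e: "m + 4 * Suc s = Suc (Suc (Suc (Suc (m + 4 * s))))"
      by simp
    show ?case
      using Suc letters[of s] unfolding e by (simp add: ones_Suc zeros_Suc numeral_eq_Suc)
  qed (simp add: balance)
  show "switched_edges w x m + 2 * s * (ones w m + s + 1) \<le> switched_edges w x (m + 4 * s)"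
  proof (induction s)
    case (Suc s)
    have "switched_edges w x (m + 4 * s) + (2 * ones w (m + 4 * s) + 4) \<le> switched_edges w x (m + 4 * s + 4)"
      using letters[of s] count[of s] by (intro switched_edges_append_1100) simp_all
    with Suc show ?case
      unfolding step using count[of s] by (simp add: algebra_simps)
  qed simp
  show "alternating_triples w (m + 4 * s) =
      alternating_triples w m + (\<Sum>j<s. 2 * (ones w m + 2 * j + 2)\<^sup>2)"
  proof (induction s)
    case (Suc s)
    have "alternating_triples w (m + 4 * s + 4) = alternating_triples w (m + 4 * s)
        + 2 * zeros w (m + 4 * s) * (ones w (m + 4 * s) + 2)"
      using letters[of s] by (intro alternating_triples_append_1100) simp_all
    with Suc show ?case
      unfolding step using count[of s] by (simp add: power2_eq_square)
  qed simp
qed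

text \<open>
  The word \<open>00(1100)(1100)\<dots>\<close>.
\<close>

definition word_2_mod_4 :: "nat \<Rightarrow> bool" where
  "word_2_mod_4 i \<longleftrightarrow> even ((i + 1) div 2)"

text \<open>
  The word \<open>0100(1100)(1100)\<dots>\<close>.
\<close>

definition word_0_mod_4 :: "nat \<Rightarrow> bool" where
  "word_0_mod_4 i \<longleftrightarrow> i \<noteq> 1 \<and> odd ((i + 1) div 2)"

lemma word_2_mod_4:
  shows "2 * s * (s + 1) \<le> switched_edges word_2_mod_4 x (4 * s + 2)"
    and "3 * alternating_triples word_2_mod_4 (4 * s + 2) = 4 * s * (s + 1) * (2 * s + 1)"
proof -
  have small: "\<not> word_2_mod_4 1" "\<not> word_2_mod_4 2"
    by (simp_all add: word_2_mod_4_def)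
  have base: "ones word_2_mod_4 2 = 0" "zeros word_2_mod_4 2 = 2"
    "alternating_triples word_2_mod_4 2 = 0"
    using small by (simp_all add: ones_def zeros_def alternating_triples_def numeral_eq_Suc)
  have letters: "word_2_mod_4 (2 + 4 * j + 1)" "word_2_mod_4 (2 + 4 * j + 2)"
    "\<not> word_2_mod_4 (2 + 4 * j + 3)" "\<not> word_2_mod_4 (2 + 4 * j + 4)" for j
    unfolding word_2_mod_4_def by presburger+
  show "2 * s * (s + 1) \<le> switched_edges word_2_mod_4 x (4 * s + 2)"
    using doubled_alternating_tail(1)[of word_2_mod_4 2 x s] letters base
    by (simp add: add.commute)
  have "3 * (\<Sum>j<s. 2 * (2 * j + 2)\<^sup>2) = 4 * s * (s + 1) * (2 * s + 1)" for s :: nat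
    by (induction s) (simp_all add: algebra_simps power2_eq_square)
  then show "3 * alternating_triples word_2_mod_4 (4 * s + 2) = 4 * s * (s + 1) * (2 * s + 1)"
    using doubled_alternating_tail(2)[of word_2_mod_4 2 s] letters base
    by (simp add: add.commute)
qed

lemma word_0_mod_4:
  shows "2 * s * (s + 2) + 1 \<le> switched_edges word_0_mod_4 x (4 * s + 4)"
    and "3 * alternating_triples word_0_mod_4 (4 * s + 4) = (2 * s + 1) * (s + 1) * (4 * s + 6)"
proof -
  have small: "\<not> word_0_mod_4 1" "word_0_mod_4 2" "\<not> word_0_mod_4 3" "\<not> word_0_mod_4 4"
    by (simp_all add: word_0_mod_4_def)
  have base: "ones word_0_mod_4 4 = 1" "zeros word_0_mod_4 4 = 3"
    "alternating_triples word_0_mod_4 4 = 2"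
    using small by (simp_all add: ones_Suc zeros_Suc alternating_triples_Suc jumps_to_Suc numeral_eq_Suc)
       (simp_all add: ones_def zeros_def alternating_triples_def jumps_to_def)
  have sw: "1 \<le> switched_edges word_0_mod_4 x 4"
    using small by (cases "x 1"; cases "x 2"; cases "x 3"; cases "x 4")
       (simp_all add: switched_edges_def switched_edge_def numeral_eq_Suc del: sum_of_bool_eq)
  have letters: "word_0_mod_4 (4 + 4 * j + 1)" "word_0_mod_4 (4 + 4 * j + 2)"
    "\<not> word_0_mod_4 (4 + 4 * j + 3)" "\<not> word_0_mod_4 (4 + 4 * j + 4)" for j
    unfolding word_0_mod_4_def by presburger+
  show "2 * s * (s + 2) + 1 \<le> switched_edges word_0_mod_4 x (4 * s + 4)"
    using doubled_alternating_tail(1)[of word_0_mod_4 4 x s] letters base sw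
    by (simp add: add.commute)
  have "6 + 3 * (\<Sum>j<s. 2 * (2 * j + 3)\<^sup>2) = (2 * s + 1) * (s + 1) * (4 * s + 6)" for s :: nat
    by (induction s) (simp_all add: algebra_simps power2_eq_square)
  then show "3 * alternating_triples word_0_mod_4 (4 * s + 4) = (2 * s + 1) * (s + 1) * (4 * s + 6)"
    using doubled_alternating_tail(2)[of word_0_mod_4 4 s] letters base
    by (simp add: add.commute eval_nat_numeral)
qed

section \<open>The cosystolic norm on a finite complex\<close>

lemma finite_simplices: "finite X \<Longrightarrow> finite (simplices X k)"
  by (simp add: simplices_def)

lemma finite_cochains:
  assumes "finite X"
  shows "finite (cochains X k)"
proof -
  have "(UNIV :: bit set) = {0, 1}"
    by (auto intro: bit.exhaust)
  then have "finite (UNIV :: bit set)"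
    by (metis finite.emptyI finite.insertI)
  from finite_set_of_finite_funs[OF finite_simplices[OF assms, of k] this, of 0]
  show ?thesis
    by (rule rev_finite_subset) (auto simp: cochains_def)
qed

lemma zero_cochain: "(\<lambda>_. 0) \<in> cochains X k"
  by (simp add: cochains_def)

lemma cosystolic_norm_le:
  assumes "finite X" "d \<in> cochains X (k - 1)"
  shows "cosystolic_norm X k c \<le> cochain_norm X k (\<lambda>\<sigma>. c \<sigma> + coboundary X (k - 1) d \<sigma>)"
  unfolding cosystolic_norm_def
  using assms by (intro Min_le finite_imageI finite_cochains) auto

lemma cosystolic_norm_attained:
  assumes "finite X"
  obtains d where "d \<in> cochains X (k - 1)"
    "cosystolic_norm X k c = cochain_norm X k (\<lambda>\<sigma>. c \<sigma> + coboundary X (k - 1) d \<sigma>)"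
proof -
  have "cosystolic_norm X k c \<in>
    (\<lambda>d. cochain_norm X k (\<lambda>\<sigma>. c \<sigma> + coboundary X (k - 1) d \<sigma>)) ` cochains X (k - 1)"
    unfolding cosystolic_norm_def
    using finite_cochains[OF assms] zero_cochain by (intro Min_in) blast+
  then show thesis
    using that by blast
qed

lemma cosystolic_norm_eq_0_iff:
  assumes "finite X" "c \<in> cochains X k"
  shows "cosystolic_norm X k c = 0 \<longleftrightarrow> c \<in> coboundary X (k - 1) ` cochains X (k - 1)"
proof -
  have norm_0: "cochain_norm X k (\<lambda>\<sigma>. c \<sigma> + coboundary X (k - 1) d \<sigma>) = 0 \<longleftrightarrow>
      c = coboundary X (k - 1) d" for d
  proof -
    have add: "a + b = (1 :: bit) \<longleftrightarrow> a \<noteq> b" for a b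
      by (cases a; cases b) simp_all
    have "c \<sigma> = coboundary X (k - 1) d \<sigma>" if "\<sigma> \<notin> simplices X k" for \<sigma>
      using that assms(2) by (simp add: cochains_def coboundary_def)
    then show ?thesis
      using finite_simplices[OF assms(1), of k]
      unfolding cochain_norm_def add fun_eq_iff by auto
  qed
  show ?thesis
  proof
    assume "cosystolic_norm X k c = 0"
    moreover obtain d where d: "d \<in> cochains X (k - 1)"
      "cosystolic_norm X k c = cochain_norm X k (\<lambda>\<sigma>. c \<sigma> + coboundary X (k - 1) d \<sigma>)"
      using cosystolic_norm_attained[OF assms(1)] by blast
    ultimately have "c = coboundary X (k - 1) d"
      by (simp only: norm_0)
    with d(1) show "c \<in> coboundary X (k - 1) ` cochains X (k - 1)"
      by blast
  next
    assume "c \<in> coboundary X (k - 1) ` cochains X (k - 1)"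
    then obtain d where d: "d \<in> cochains X (k - 1)" "c = coboundary X (k - 1) d"
      by blast
    have "cochain_norm X k (\<lambda>\<sigma>. c \<sigma> + coboundary X (k - 1) d \<sigma>) = 0"
      using d(2) by (rule iffD2[OF norm_0])
    with cosystolic_norm_le[OF assms(1) d(1), of c] show "cosystolic_norm X k c = 0"
      by linarith
  qed
qed

lemma cheeger_constant_le:
  assumes "finite X" "c \<in> cochains X k" "0 < L" "L \<le> cosystolic_norm X k c"
  shows "cheeger_constant k X \<le> cochain_norm X (k + 1) (coboundary X k c) / L"
proof -
  have "c \<in> cochains X k - coboundary X (k - 1) ` cochains X (k - 1)"
    using assms cosystolic_norm_eq_0_iff[of X c k] by auto
  then have "cheeger_constant k X \<le>
      cochain_norm X (k + 1) (coboundary X k c) / cosystolic_norm X k c"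
    unfolding cheeger_constant_def using finite_cochains[OF assms(1), of k]
    by (intro Min_le) auto
  also have "\<dots> \<le> cochain_norm X (k + 1) (coboundary X k c) / L"
    using assms(3,4) by (intro divide_left_mono) auto
  finally show ?thesis .
qed

section \<open>The lower bound by switching at vertices\<close>

lemma mem_simplices_full_simplex:
  "\<sigma> \<in> simplices (full_simplex V) k \<longleftrightarrow> \<sigma> \<subseteq> V \<and> finite \<sigma> \<and> int (card \<sigma>) = k + 1"
  by (auto simp: simplices_def full_simplex_def)

lemma coboundary_edge:
  assumes "u \<in> V" "v \<in> V" "u \<noteq> v"
  shows "coboundary (full_simplex V) 0 d {u, v} = d {u} + d {v}"
proof -
  have "{\<sigma> \<in> simplices (full_simplex V) 0. \<sigma> \<subseteq> {u, v}} = {{u}, {v}}"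
    using assms by (auto simp: mem_simplices_full_simplex card_1_singleton_iff)
  moreover have "{u, v} \<in> simplices (full_simplex V) 1"
    using assms by (simp add: mem_simplices_full_simplex)
  ultimately show ?thesis
    using assms by (simp add: coboundary_def)
qed

lemma coboundary_triangle:
  assumes "u \<in> V" "v \<in> V" "t \<in> V" "u \<noteq> v" "v \<noteq> t" "u \<noteq> t"
  shows "coboundary (full_simplex V) 1 c {u, v, t} = c {u, v} + c {u, t} + c {v, t}"
proof -
  have "{\<sigma> \<in> simplices (full_simplex V) 1. \<sigma> \<subseteq> {u, v, t}} = {{u, v}, {u, t}, {v, t}}"
    using assms by (auto simp: mem_simplices_full_simplex card_2_iff)
  moreover have "{u, v, t} \<in> simplices (full_simplex V) 2"
    using assms by (simp add: mem_simplices_full_simplex)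
  moreover have "{u, v} \<noteq> {u, t}" "{u, v} \<noteq> {v, t}" "{u, t} \<noteq> {v, t}"
    using assms by (auto simp: doubleton_eq_iff)
  ultimately show ?thesis
    by (cases "c {u, v}"; cases "c {u, t}"; cases "c {v, t}") (simp_all add: coboundary_def)
qed

text \<open>
  The cut used here is the neighbourhood of \<open>v\<close>. After switching along it \<open>v\<close> is isolated, and a pair
  \<open>{a, b}\<close> avoiding \<open>v\<close> is an edge iff the coboundary is 1 on \<open>{v, a, b}\<close>.
\<close>

lemma cosystolic_norm_le_degree:
  assumes "finite V" "v \<in> V"
  shows "cosystolic_norm (full_simplex V) 1 c \<le>
    card {\<tau> \<in> simplices (full_simplex V) 2. coboundary (full_simplex V) 1 c \<tau> = 1 \<and> v \<in> \<tau>}"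
    (is "_ \<le> card ?T")
proof -
  let ?X = "full_simplex V"
  have fin: "finite ?X"
    using assms(1) by (simp add: full_simplex_def)
  define d where "d \<sigma> = (if \<sigma> \<in> simplices ?X 0 \<and> \<sigma> \<noteq> {v} then c (insert v \<sigma>) else 0)" for \<sigma>
  have d_vertex: "d {u} = (if u = v then 0 else c {v, u})" if "u \<in> V" for u
    using that by (simp add: d_def mem_simplices_full_simplex)
  let ?E = "{\<sigma> \<in> simplices ?X 1. c \<sigma> + coboundary ?X 0 d \<sigma> = 1}"
  have E: "v \<notin> \<sigma> \<and> insert v \<sigma> \<in> ?T" if "\<sigma> \<in> ?E" for \<sigma>
  proof -
    from that obtain a b where \<sigma>: "\<sigma> = {a, b}" "a \<noteq> b" "a \<in> V" "b \<in> V"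
      by (auto simp: mem_simplices_full_simplex card_2_iff)
    have sum: "c {a, b} + (d {a} + d {b}) = 1"
      using that \<sigma> by (simp add: coboundary_edge)
    have cancel: "z + z = 0" for z :: bit
      by (cases z) simp_all
    have v: "v \<noteq> a" "v \<noteq> b"
      using sum \<sigma> by (auto simp: d_vertex insert_commute cancel)
    then have "coboundary ?X 1 c {v, a, b} = 1"
      using sum \<sigma> assms(2) by (simp add: coboundary_triangle d_vertex ac_simps)
    then show ?thesis
      using \<sigma> v assms(2) by (simp add: mem_simplices_full_simplex)
  qed
  have "cosystolic_norm ?X 1 c \<le> card ?E"
    using cosystolic_norm_le[OF fin, of d 1 c] by (simp add: cochains_def cochain_norm_def d_def)
  also have "\<dots> \<le> card ?T"
  proof (rule card_inj_on_le)
    show "inj_on (insert v) ?E"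
      using E by (intro inj_onI) (metis insert_ident)
    show "insert v ` ?E \<subseteq> ?T"
      using E by blast
    show "finite ?T"
      using finite_simplices[OF fin, of 2] by simp
  qed
  finally show ?thesis .
qed

text \<open>
  Average the preceding bound over all vertices; every triangle has three of them.
\<close>

lemma coboundary_expansion:
  assumes "finite V"
  shows "card V * cosystolic_norm (full_simplex V) 1 c \<le>
    3 * cochain_norm (full_simplex V) 2 (coboundary (full_simplex V) 1 c)"
proof -
  let ?X = "full_simplex V"
  define T where "T = {\<tau> \<in> simplices ?X 2. coboundary ?X 1 c \<tau> = 1}"
  have "finite ?X"
    using assms by (simp add: full_simplex_def)
  then have fin: "finite T"
    using finite_simplices[of ?X 2] by (simp add: T_def)
  have three: "card {v \<in> V. v \<in> \<tau>} = 3" if "\<tau> \<in> T" for \<tau>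
  proof -
    have "{v \<in> V. v \<in> \<tau>} = \<tau>" and "card \<tau> = 3"
      using that by (auto simp: T_def mem_simplices_full_simplex)
    then show ?thesis by simp
  qed
  have "card V * cosystolic_norm ?X 1 c = (\<Sum>v\<in>V. cosystolic_norm ?X 1 c)"
    by simp
  also have "\<dots> \<le> (\<Sum>v\<in>V. card {\<tau> \<in> T. v \<in> \<tau>})"
    using cosystolic_norm_le_degree[OF assms]
    by (intro sum_mono) (simp add: T_def conj_assoc)
  also have "\<dots> = 3 * card T"
    using assms fin three by (intro sum_multicount) auto
  finally show ?thesis
    by (simp add: T_def cochain_norm_def)
qed

text \<open>
  The cochain \<open>c\<close> only ensures that the minimum defining the Cheeger constant is taken over a
  nonempty set.
\<close>

lemma cheeger_constant_ge:
  assumes "finite V" "c \<in> cochains (full_simplex V) 1" "0 < cosystolic_norm (full_simplex V) 1 c"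
  shows "card V / 3 \<le> cheeger_constant 1 (full_simplex V)"
proof -
  let ?X = "full_simplex V"
  let ?C = "cochains ?X 1 - coboundary ?X 0 ` cochains ?X 0"
  have fin: "finite ?X"
    using assms(1) by (simp add: full_simplex_def)
  have non_coboundary: "a \<in> ?C \<longleftrightarrow> a \<in> cochains ?X 1 \<and> 0 < cosystolic_norm ?X 1 a" for a
    using cosystolic_norm_eq_0_iff[OF fin, of a 1] by auto
  have bound: "card V / 3 \<le> real (cochain_norm ?X 2 (coboundary ?X 1 a)) / cosystolic_norm ?X 1 a"
    if "a \<in> ?C" for a
  proof -
    have "real (card V * cosystolic_norm ?X 1 a) \<le> real (3 * cochain_norm ?X 2 (coboundary ?X 1 a))"
      using coboundary_expansion[OF assms(1), of a] by (rule of_nat_mono)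
    moreover have "0 < real (cosystolic_norm ?X 1 a)"
      using that non_coboundary by simp
    ultimately show ?thesis
      by (simp add: field_simps)
  qed
  have "c \<in> ?C"
    using assms non_coboundary by blast
  then have "?C \<noteq> {}"
    by blast
  then show ?thesis
    unfolding cheeger_constant_def using finite_cochains[OF fin, of 1] bound
    by (subst Min_ge_iff) auto
qed

section \<open>Counting simplices by their largest vertex\<close>

text \<open>
  The simplex on \<open>m\<close> vertices is the cone with apex \<open>m\<close> over the simplex on the smaller vertices.
\<close>

lemma simplices_full_simplex_Suc:
  assumes "1 \<le> m"
  shows "simplices (full_simplex {1..<Suc m}) k =
    simplices (full_simplex {1..<m}) k \<union> insert m ` simplices (full_simplex {1..<m}) (k - 1)"
    (is "?L = ?A \<union> insert m ` ?B")
proof -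
  have interval: "{1..<Suc m} = insert m {1..<m}"
    using assms by auto
  show ?thesis
  proof (intro equalityI subsetI)
    fix \<sigma> assume \<sigma>: "\<sigma> \<in> ?L"
    then have vertices: "\<sigma> \<subseteq> insert m {1..<m}"
      using interval by (simp add: mem_simplices_full_simplex)
    show "\<sigma> \<in> ?A \<union> insert m ` ?B"
    proof (cases "m \<in> \<sigma>")
      case True
      have "Suc (card (\<sigma> - {m})) = card \<sigma>"
        using \<sigma> True by (intro card_Suc_Diff1) (simp_all add: mem_simplices_full_simplex)
      moreover have "\<sigma> - {m} \<subseteq> {1..<m}"
        using vertices by blast
      ultimately have "\<sigma> - {m} \<in> ?B"
        using \<sigma> by (simp add: mem_simplices_full_simplex)
      moreover have "\<sigma> = insert m (\<sigma> - {m})"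
        using True by blast
      ultimately show ?thesis
        by blast
    next
      case False
      then have "\<sigma> \<subseteq> {1..<m}"
        using vertices by blast
      then show ?thesis
        using \<sigma> by (simp add: mem_simplices_full_simplex)
    qed
  next
    fix \<sigma> assume "\<sigma> \<in> ?A \<union> insert m ` ?B"
    then consider "\<sigma> \<in> ?A" | \<rho> where "\<rho> \<in> ?B" "\<sigma> = insert m \<rho>"
      by blast
    then show "\<sigma> \<in> ?L"
    proof cases
      case 1
      then show ?thesis
        unfolding interval mem_simplices_full_simplex by blast
    next
      case 2
      then have "m \<notin> \<rho>" by (auto simp: mem_simplices_full_simplex)
      with 2 show ?thesis
        unfolding interval mem_simplices_full_simplex by auto
    qed
  qed
qed

text \<open>
  Grouping simplices by their largest vertex reduces the dimension by one. Down to the empty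
  simplex in dimension -1, this turns norms into the iterated sums over \<open>u < v < t\<close> by which edges
  and triples of word graphs are counted.
\<close>

lemma cochain_norm_by_last_vertex:
  fixes m :: nat
  assumes "0 \<le> k"
  shows "cochain_norm (full_simplex {1..<m}) k f =
    (\<Sum>v\<in>{1..<m}. cochain_norm (full_simplex {1..<v}) (k - 1) (\<lambda>\<sigma>. f (insert v \<sigma>)))"
proof (induction m)
  case 0
  have "simplices (full_simplex ({} :: nat set)) k = {}"
    using assms by (auto simp: mem_simplices_full_simplex)
  then show ?case
    by (simp add: cochain_norm_def)
next
  case (Suc m)
  show ?case
  proof (cases "m = 0")
    case True
    have "simplices (full_simplex ({} :: nat set)) k = {}"
      using assms by (auto simp: mem_simplices_full_simplex)
    then show ?thesis
      using True by (simp add: cochain_norm_def)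
  next
    case False
    let ?A = "simplices (full_simplex {1..<m}) k" and ?B = "simplices (full_simplex {1..<m}) (k - 1)"
    have fin: "finite ?A" "finite ?B"
      by (simp_all add: finite_simplices full_simplex_def)
    have notin: "m \<notin> \<sigma>" if "\<sigma> \<in> ?A \<union> ?B" for \<sigma>
      using that by (auto simp: mem_simplices_full_simplex)
    have "{\<sigma> \<in> simplices (full_simplex {1..<Suc m}) k. f \<sigma> = 1} =
        {\<sigma> \<in> ?A. f \<sigma> = 1} \<union> insert m ` {\<sigma> \<in> ?B. f (insert m \<sigma>) = 1}"
      using simplices_full_simplex_Suc[of m k] False by auto
    moreover have "card (insert m ` {\<sigma> \<in> ?B. f (insert m \<sigma>) = 1}) = card {\<sigma> \<in> ?B. f (insert m \<sigma>) = 1}"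
      by (intro card_image inj_onI) (use notin in \<open>metis (no_types, lifting) UnI2 insert_ident mem_Collect_eq\<close>)
    moreover have "{\<sigma> \<in> ?A. f \<sigma> = 1} \<inter> insert m ` {\<sigma> \<in> ?B. f (insert m \<sigma>) = 1} = {}"
      using notin by blast
    ultimately have "cochain_norm (full_simplex {1..<Suc m}) k f =
        cochain_norm (full_simplex {1..<m}) k f
        + cochain_norm (full_simplex {1..<m}) (k - 1) (\<lambda>\<sigma>. f (insert m \<sigma>))"
      using fin by (simp add: cochain_norm_def card_Un_disjoint)
    with Suc False show ?thesis
      by simp
  qed
qed

lemma cochain_norm_empty: "cochain_norm (full_simplex V) (- 1) f = of_bool (f {} = 1)"
proof -
  have "simplices (full_simplex V) (- 1) = {{}}"
    by (auto simp: mem_simplices_full_simplex)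
  then have "{\<sigma> \<in> simplices (full_simplex V) (- 1). f \<sigma> = 1} = (if f {} = 1 then {{}} else {})"
    by auto
  then show ?thesis
    by (simp add: cochain_norm_def)
qed

lemma cochain_norm_vertices:
  fixes m :: nat
  shows "cochain_norm (full_simplex {1..<m}) 0 f = (\<Sum>u\<in>{1..<m}. of_bool (f {u} = 1))"
  using cochain_norm_by_last_vertex[of 0 m f]
  by (simp add: cochain_norm_empty del: sum_of_bool_eq)

lemma cochain_norm_edges:
  fixes m :: nat
  shows "cochain_norm (full_simplex {1..<m}) 1 f =
    (\<Sum>v\<in>{1..<m}. \<Sum>u\<in>{1..<v}. of_bool (f {v, u} = 1))"
  using cochain_norm_by_last_vertex[of 1 m f]
  by (simp add: cochain_norm_vertices[simplified])

lemma cochain_norm_triangles: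
  fixes m :: nat
  shows "cochain_norm (full_simplex {1..<m}) 2 f =
    (\<Sum>t\<in>{1..<m}. \<Sum>v\<in>{1..<t}. \<Sum>u\<in>{1..<v}. of_bool (f {t, v, u} = 1))"
  using cochain_norm_by_last_vertex[of 2 m f]
  by (simp add: cochain_norm_edges[simplified])

section \<open>Cochains of words\<close>

definition word_cochain :: "nat \<Rightarrow> (nat \<Rightarrow> bool) \<Rightarrow> nat set \<Rightarrow> bit" where
  "word_cochain n w \<sigma> =
    of_bool (\<sigma> \<in> simplices (full_simplex {1..n}) 1 \<and> w (Min \<sigma>) \<and> \<not> w (Max \<sigma>))"

lemma word_cochain_edge:
  assumes "1 \<le> u" "u < v" "v \<le> n"
  shows "word_cochain n w {v, u} = of_bool (w u \<and> \<not> w v)"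
  using assms by (simp add: word_cochain_def mem_simplices_full_simplex)

lemma of_bool_add_bit: "(of_bool P :: bit) + of_bool Q = of_bool (P \<noteq> Q)"
  by (cases P; cases Q) simp_all

lemma cochain_norm_switched_word:
  "cochain_norm (full_simplex {1..n}) 1
      (\<lambda>\<sigma>. word_cochain n w \<sigma> + coboundary (full_simplex {1..n}) 0 d \<sigma>) =
    switched_edges w (\<lambda>u. d {u} = 1) n"
proof -
  have d: "d \<sigma> = of_bool (d \<sigma> = 1)" for \<sigma>
    by (cases "d \<sigma>") simp_all
  have "word_cochain n w {v, u} + coboundary (full_simplex {1..n}) 0 d {v, u} = 1 \<longleftrightarrow>
      switched_edge w (\<lambda>u. d {u} = 1) u v" if "v \<in> {1..n}" "u \<in> {1..<v}" for u v
    using that d[of "{u}"] d[of "{v}"]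
    by (cases "d {u}"; cases "d {v}")
       (auto simp: coboundary_edge word_cochain_edge switched_edge_def)
  then show ?thesis
    unfolding cochain_norm_edges[of "Suc n", unfolded atLeastLessThanSuc_atLeastAtMost]
      switched_edges_def
    by (intro sum.cong refl) simp
qed

text \<open>
  Among the letters of \<open>u < v < t\<close>, an odd number of the three pairs reads \<open>10\<close> iff the letters are
  \<open>010\<close> or \<open>101\<close>.
\<close>

lemma cochain_norm_coboundary_word:
  "cochain_norm (full_simplex {1..n}) 2 (coboundary (full_simplex {1..n}) 1 (word_cochain n w)) =
    alternating_triples w n"
proof -
  have "coboundary (full_simplex {1..n}) 1 (word_cochain n w) {t, v, u} = 1 \<longleftrightarrow>
      w u \<noteq> w v \<and> w v \<noteq> w t" if "t \<in> {1..n}" "v \<in> {1..<t}" "u \<in> {1..<v}" for t u v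
    using that by (auto simp: coboundary_triangle word_cochain_edge of_bool_add_bit)
  then show ?thesis
    unfolding cochain_norm_triangles[of "Suc n", unfolded atLeastLessThanSuc_atLeastAtMost]
      alternating_triples_def
    by (intro sum.cong refl) simp
qed

lemma cheeger_constant_word:
  assumes "0 < L" and switched: "\<And>x. L \<le> switched_edges w x n"
  shows "real n / 3 \<le> cheeger_constant 1 (full_simplex {1..n})"
    and "cheeger_constant 1 (full_simplex {1..n}) \<le> alternating_triples w n / L"
proof -
  let ?X = "full_simplex {1..n}"
  have fin: "finite ?X"
    by (simp add: full_simplex_def)
  have cochain: "word_cochain n w \<in> cochains ?X 1"
    by (simp add: cochains_def word_cochain_def)
  have L: "L \<le> cosystolic_norm ?X 1 (word_cochain n w)"
  proof -
    obtain d where "cosystolic_norm ?X 1 (word_cochain n w) =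
        cochain_norm ?X 1 (\<lambda>\<sigma>. word_cochain n w \<sigma> + coboundary ?X (1 - 1) d \<sigma>)"
      using cosystolic_norm_attained[OF fin] by blast
    then show ?thesis
      using switched by (simp only: diff_self cochain_norm_switched_word)
  qed
  show "real n / 3 \<le> cheeger_constant 1 ?X"
    using cheeger_constant_ge[OF _ cochain] L assms(1) by simp
  show "cheeger_constant 1 ?X \<le> alternating_triples w n / L"
    using cheeger_constant_le[OF fin cochain assms(1) L]
    by (simp only: one_add_one cochain_norm_coboundary_word)
qed

section \<open>Convergence of the Cheeger constants\<close>

text \<open>
  If 4 does not divide \<open>n\<close>, the words attain the lower bound \<open>n / 3\<close>. The error term comes from the
  multiples of 4, where the word has an excess over \<open>n / 3\<close> of order \<open>1 / n\<close>.
\<close>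

theorem cheeger_constant_bounds:
  assumes "3 \<le> n"
  shows "real n / 3 \<le> cheeger_constant 1 (full_simplex {1..n})"
    and "cheeger_constant 1 (full_simplex {1..n}) \<le> real n / 3 + 3 / real n"
proof -
  let ?h = "cheeger_constant 1 (full_simplex {1..n})"
  have error: "0 \<le> 3 / real n"
    by simp
  have "n mod 4 < 4"
    by simp
  then have "odd n \<or> n mod 4 = 2 \<or> n mod 4 = 0"
    by presburger
  then have "n = 2 * (n div 2) + 1 \<and> 1 \<le> n div 2 \<or>
      n = 4 * (n div 4) + 2 \<and> 1 \<le> n div 4 \<or> n = 4 * (n div 4 - 1) + 4"
    using assms by presburger
  then consider s where "n = 2 * s + 1" "1 \<le> s" | s where "n = 4 * s + 2" "1 \<le> s"
    | s where "n = 4 * s + 4"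
    by metis
  then have "real n / 3 \<le> ?h \<and> ?h \<le> real n / 3 + 3 / real n"
  proof cases
    case 1
    obtain L where two_L: "s * (s + 1) = 2 * L"
      by (metis even_mult_iff odd_even_add odd_one evenE)
    have L: "L \<le> switched_edges even x n" for x
      using alternating_word(1)[of s x] 1 two_L by simp
    have pos: "0 < L"
      using 1 two_L by (cases L) auto
    have "6 * real (alternating_triples even n) = real (s * (s + 1) * (2 * s + 1))"
      unfolding alternating_word(2)[symmetric] 1 by simp
    also have "\<dots> = 2 * real L * real n"
      unfolding two_L 1 by (simp add: algebra_simps)
    finally have "alternating_triples even n / L = real n / 3"
      using pos by (simp add: field_simps)
    then show ?thesis
      using cheeger_constant_word[OF pos L] error by linarith
  next
    case 2
    define L where "L = 2 * s * (s + 1)"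
    have L: "L \<le> switched_edges word_2_mod_4 x n" for x
      using word_2_mod_4(1)[of s x] 2 by (simp add: L_def)
    have pos: "0 < L"
      using 2 by (simp add: L_def)
    have "3 * alternating_triples word_2_mod_4 n = L * n"
      using word_2_mod_4(2)[of s] 2 by (simp add: L_def algebra_simps)
    then have "3 * real (alternating_triples word_2_mod_4 n) = real L * real n"
      by (metis of_nat_mult of_nat_numeral)
    then have "alternating_triples word_2_mod_4 n / L = real n / 3"
      using pos by (simp add: field_simps)
    then show ?thesis
      using cheeger_constant_word[OF pos L] error by linarith
  next
    case 3
    have L: "2 * s * (s + 2) + 1 \<le> switched_edges word_0_mod_4 x n" for x
      using word_0_mod_4(1)[of s x] 3 by simp
    have pos: "0 < 2 * s * (s + 2) + 1"
      by simp
    have T: "3 * real (alternating_triples word_0_mod_4 n) = real ((2 * s + 1) * (s + 1) * (4 * s + 6))"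
      unfolding word_0_mod_4(2)[symmetric] 3 by simp
    \<comment> \<open>With \<open>r = n / 4\<close>, the denominator is \<open>D = 2 r\<^sup>2 - 1\<close>, so the excess over \<open>n / 3\<close> is of order
      \<open>1 / r\<close>.\<close>
    define r D where "r = real s + 1" and "D = 2 * r\<^sup>2 - 1"
    have r: "1 \<le> r\<^sup>2" "0 < r"
      by (simp_all add: r_def)
    then have D_pos: "0 < D"
      by (simp add: D_def)
    have D: "real (2 * s * (s + 2) + 1) = D"
      by (simp add: D_def r_def power2_eq_square algebra_simps)
    have n: "real n = 4 * r"
      using 3 by (simp add: r_def)
    have "real ((2 * s + 1) * (s + 1) * (4 * s + 6)) = 4 * r * D + 2 * r"
      by (simp add: D_def r_def power2_eq_square algebra_simps)
    then have "alternating_triples word_0_mod_4 n / D = real n / 3 + 2 * r / (3 * D)"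
      using T D_pos n by (simp add: field_simps)
    also have "2 * r / (3 * D) \<le> 3 / real n"
      using r D_pos n by (simp add: D_def divide_simps power2_eq_square)
    finally have "alternating_triples word_0_mod_4 n / D \<le> real n / 3 + 3 / real n"
      by simp
    then show ?thesis
      using cheeger_constant_word[OF pos L] D by simp
  qed
  then show "real n / 3 \<le> ?h" and "?h \<le> real n / 3 + 3 / real n"
    by auto
qed

theorem corollary4p7:
  "(\<lambda>n::nat. cheeger_constant 1 (full_simplex {1..n}) - real n / 3) \<longlonglongrightarrow> 0"
proof (rule tendsto_sandwich)
  show "\<forall>\<^sub>F n in sequentially. 0 \<le> cheeger_constant 1 (full_simplex {1..n}) - real n / 3"
    using cheeger_constant_bounds(1) by (intro eventually_sequentiallyI[of 3]) simp
  show "\<forall>\<^sub>F n in sequentially. cheeger_constant 1 (full_simplex {1..n}) - real n / 3 \<le> 3 / real n"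
    using cheeger_constant_bounds(2) by (intro eventually_sequentiallyI[of 3]) (simp add: algebra_simps)
  show "(\<lambda>n. 3 / real n) \<longlonglongrightarrow> 0"
    by (rule lim_const_over_n)
qed simp

end
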